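(* Let $G$ be a countable group, let $S=2=\{0,1\}$ or $S=\omega$, and let $\boldsymbol{\Gamma}$ be a reasonable pointclass. If $(\boldsymbol{\Gamma},E_G)$-determinacy holds, then $\boldsymbol{\Gamma}$-determinacy holds.
   Context: A pointclass is a collection of subsets of Polish spaces closed under continuous preimages. A pointclass $\boldsymbol{\Gamma}$ is reasonable if (1) it is closed under unions and intersections with $\boldsymbol{\Delta}^0_6$ sets, and (2) it is closed under substitutions by $\boldsymbol{\Delta}^0_6$-measurable functions. For a countable group $G$, the (left) shift action of $G$ on $S^G$ (product of discrete topologies) is $(g\cdot x)(h)=x(g^{-1}h)$, and $E_G$ is the orbit equivalence relation of this action. An enumeration of $G$ is a bijection $\pi:\omega\to G$; it induces a homeomorphism $\pi:S^\omega\to S^G$, $\pi(x)=y$ where $y(\pi(n))=x(n)$. $(\boldsymbol{\Gamma},E_G)$-determinacy means: for every $E_G$-invariant set $A\subseteq S^G$ in $\boldsymbol{\Gamma}$ and every enumeration $\pi$ of $G$, the set $\pi^{-1}(A)\subseteq S^\omega$ is determined (in the Gale–Stewart game where two players alternately play elements of $S$ and player I wins iff the resulting sequence lies in the set). $\boldsymbol{\Gamma}$-determinacy means every set in $\boldsymbol{\Gamma}$ (a subset of $S^\omega$) is determined. *)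

theory Defs
  imports "HOL-Analysis.Analysis" "HOL-Algebra.Group"
begin

definition polish_topology :: "'a topology \<Rightarrow> bool" where
  "polish_topology X \<longleftrightarrow> completely_metrizable_space X \<and> separable_space X"

text \<open>
  The finite levels of the Borel hierarchy, indexed from 1 as usual (index 0 is a dummy).
\<close>

fun Sigma0 :: "'a topology \<Rightarrow> nat \<Rightarrow> 'a set set" where
  "Sigma0 X 0 = {}"
| "Sigma0 X (Suc 0) = {U. openin X U}"
| "Sigma0 X (Suc (Suc n)) =
     {\<Union>k. B k | B :: nat \<Rightarrow> 'a set.
        \<forall>k. B k \<subseteq> topspace X \<and> topspace X - B k \<in> Sigma0 X (Suc n)}"

definition Pi0 :: "'a topology \<Rightarrow> nat \<Rightarrow> 'a set set" where
  "Pi0 X n = {A. A \<subseteq> topspace X \<and> topspace X - A \<in> Sigma0 X n}"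

definition Delta0 :: "'a topology \<Rightarrow> nat \<Rightarrow> 'a set set" where
  "Delta0 X n = Sigma0 X n \<inter> Pi0 X n"

definition Delta0_measurable_map ::
    "nat \<Rightarrow> 'a topology \<Rightarrow> 'b topology \<Rightarrow> ('a \<Rightarrow> 'b) \<Rightarrow> bool" where
  "Delta0_measurable_map n X Y f \<longleftrightarrow>
     f \<in> topspace X \<rightarrow> topspace Y \<and>
     (\<forall>U. openin Y U \<longrightarrow> f -` U \<inter> topspace X \<in> Delta0 X n)"

text \<open>
  A pointclass ranges over all Polish spaces. A single HOL term cannot range over all types,
  so a pointclass is given by its values \<open>\<Gamma> X\<close> on the Polish spaces \<open>X\<close> whose points
  form a subset of the type \<^typ>\<open>nat \<Rightarrow> nat\<close>; the topology of \<open>X\<close> is arbitrary and need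
  not be related to that of the Baire space. Every Polish space, over any type, is homeomorphic
  to such an \<open>X\<close> (lemma \<open>polish_topology_copy\<close>), and closure under continuous preimages
  makes membership invariant under homeomorphism. So \<open>\<Gamma>\<close> determines the sets
  of the pointclass in every Polish space, through \<open>in_pointclass\<close>.
\<close>

type_synonym set_family = "(nat \<Rightarrow> nat) topology \<Rightarrow> (nat \<Rightarrow> nat) set set"

definition pointclass :: "set_family \<Rightarrow> bool" where
  "pointclass \<Gamma> \<longleftrightarrow>
     (\<forall>X A. A \<in> \<Gamma> X \<longrightarrow> polish_topology X \<and> A \<subseteq> topspace X) \<and>
     (\<forall>X Y f A. polish_topology X \<longrightarrow> continuous_map X Y f \<longrightarrow> A \<in> \<Gamma> Y \<longrightarrow>
        f -` A \<inter> topspace X \<in> \<Gamma> X)"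

definition reasonable_pointclass :: "set_family \<Rightarrow> bool" where
  "reasonable_pointclass \<Gamma> \<longleftrightarrow>
     pointclass \<Gamma> \<and>
     (\<forall>X A B. A \<in> \<Gamma> X \<longrightarrow> B \<in> Delta0 X 6 \<longrightarrow> A \<union> B \<in> \<Gamma> X \<and> A \<inter> B \<in> \<Gamma> X) \<and>
     (\<forall>X Y f A. polish_topology X \<longrightarrow> Delta0_measurable_map 6 X Y f \<longrightarrow> A \<in> \<Gamma> Y \<longrightarrow>
        f -` A \<inter> topspace X \<in> \<Gamma> X)"

definition in_pointclass :: "set_family \<Rightarrow> 'a topology \<Rightarrow> 'a set \<Rightarrow> bool" where
  "in_pointclass \<Gamma> X A \<longleftrightarrow>
     A \<subseteq> topspace X \<and> (\<exists>Y f. homeomorphic_map X Y f \<and> f ` A \<in> \<Gamma> Y)"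

lemma polish_topology_homeomorphic:
  assumes "X homeomorphic_space Y" "polish_topology X"
  shows "polish_topology Y"
proof -
  have "completely_metrizable_space Y"
    using assms homeomorphic_completely_metrizable_space polish_topology_def by blast
  moreover have "separable_space Y"
    using assms homeomorphic_separable_space polish_topology_def by blast
  ultimately show ?thesis by (simp add: polish_topology_def)
qed

lemma polish_topology_copy:
  fixes X :: "'a topology"
  assumes "polish_topology X"
  shows "\<exists>Y :: (nat \<Rightarrow> nat) topology. polish_topology Y \<and> X homeomorphic_space Y"
proof -
  obtain M d where Md: "Metric_space M d" "X = Metric_space.mtopology M d"
    using assms by (auto simp: polish_topology_def completely_metrizable_space_def)
  interpret Metric_space M d by (rule Md(1))
  obtain C where C: "countable C" "C \<subseteq> M" "mtopology closure_of C = M"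
    using assms by (auto simp: polish_topology_def separable_space_def Md(2))
  define \<B> where "\<B> = (\<lambda>(c, k). mball c (1 / real (Suc k))) ` (C \<times> (UNIV :: nat set))"
  have cB: "countable \<B>"
    unfolding \<B>_def using C(1) by (intro countable_image countable_SIGMA) auto
  have sep: "\<exists>V\<in>\<B>. x \<in> V \<and> y \<notin> V" if "x \<in> M" "y \<in> M" "x \<noteq> y" for x y
  proof -
    have "d x y > 0" using that by simp
    then obtain k where k: "1 / real (Suc k) < d x y / 2"
      using nat_approx_posE[of "d x y / 2"] by auto
    have "x \<in> mtopology closure_of C" using that C by simp
    moreover have "1 / real (Suc k) > 0" by simp
    ultimately obtain c where c: "c \<in> C" "c \<in> mball x (1 / real (Suc k))"
      unfolding metric_closure_of by blast
    then have "x \<in> mball c (1 / real (Suc k))" by (simp add: commute)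
    moreover have "y \<notin> mball c (1 / real (Suc k))"
    proof
      assume "y \<in> mball c (1 / real (Suc k))"
      then have "d c y < 1 / real (Suc k)" "d x c < 1 / real (Suc k)" "c \<in> M"
        using c by auto
      then show False using triangle[of x c y] that k by linarith
    qed
    ultimately show ?thesis using c(1) by (auto simp: \<B>_def)
  qed
  define B where "B n = from_nat_into (insert {} \<B>) n" for n
  have B: "range B = insert {} \<B>"
    unfolding B_def[abs_def] using cB by (intro range_from_nat_into) auto
  define f where "f x = (\<lambda>n. if x \<in> B n then 1 else (0::nat))" for x
  have inj: "inj_on f (topspace X)"
  proof (rule inj_onI, rule ccontr)
    fix x y assume xy: "x \<in> topspace X" "y \<in> topspace X" "f x = f y" "x \<noteq> y"
    then obtain V where V: "V \<in> \<B>" "x \<in> V" "y \<notin> V"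
      using sep[of x y] Md(2) by auto
    then obtain n where "V = B n"
      using B by (metis insertI2 rangeE)
    then have "f x n \<noteq> f y n"
      using V by (auto simp: f_def)
    then show False using xy by simp
  qed
  define g where "g = inv_into (topspace X) f"
  define Y where "Y = pullback_topology (f ` topspace X) g X"
  have gf: "g (f x) = x" if "x \<in> topspace X" for x
    using inj that by (simp add: g_def)
  have tY: "topspace Y = f ` topspace X"
    using gf by (auto simp: Y_def topspace_pullback_topology)
  have "homeomorphic_maps X Y f g"
    unfolding homeomorphic_maps_def
  proof (intro conjI ballI)
    show "continuous_map X Y f"
      unfolding Y_def
    proof (rule continuous_map_pullback')
      show "continuous_map X X (g \<circ> f)"
        by (rule continuous_map_eq[OF continuous_map_id]) (simp add: gf)
    qed auto
    show "continuous_map Y X g"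
      unfolding Y_def using continuous_map_pullback[OF continuous_map_id, where f=g and A="f ` topspace X"]
      by (simp only: id_o)
  qed (use gf tY in auto)
  then have "X homeomorphic_space Y"
    by (auto simp: homeomorphic_space_def)
  then show ?thesis
    using assms polish_topology_homeomorphic by blast
qed

lemma in_pointclass_iff:
  assumes "pointclass \<Gamma>"
  shows "in_pointclass \<Gamma> X A \<longleftrightarrow> A \<in> \<Gamma> X"
proof
  assume "in_pointclass \<Gamma> X A"
  then obtain Y f where A: "A \<subseteq> topspace X" and f: "homeomorphic_map X Y f" "f ` A \<in> \<Gamma> Y"
    by (auto simp: in_pointclass_def)
  have "polish_topology Y"
    using assms f(2) by (auto simp: pointclass_def)
  then have X: "polish_topology X"
    using f(1) polish_topology_homeomorphic homeomorphic_space_sym homeomorphic_map_imp_homeomorphic_space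
    by blast
  have "f -` f ` A \<inter> topspace X = A"
    using A f(1) by (auto simp: homeomorphic_map_def inj_on_def)
  moreover have "f -` f ` A \<inter> topspace X \<in> \<Gamma> X"
    using assms X f homeomorphic_imp_continuous_map unfolding pointclass_def by blast
  ultimately show "A \<in> \<Gamma> X" by simp
next
  assume "A \<in> \<Gamma> X"
  moreover have "homeomorphic_map X X id" by simp
  ultimately show "in_pointclass \<Gamma> X A"
    using assms by (auto simp: in_pointclass_def pointclass_def intro!: exI[of _ X] exI[of _ id])
qed

definition power_space :: "nat set \<Rightarrow> 'i set \<Rightarrow> ('i \<Rightarrow> nat) topology" where
  "power_space S I = product_topology (\<lambda>_. discrete_topology S) I"

definition shift :: "('g, 'm) monoid_scheme \<Rightarrow> 'g \<Rightarrow> ('g \<Rightarrow> nat) \<Rightarrow> 'g \<Rightarrow> nat" where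
  "shift G g x = (\<lambda>h\<in>carrier G. x (inv\<^bsub>G\<^esub> g \<otimes>\<^bsub>G\<^esub> h))"

definition orbit_equivalence ::
    "nat set \<Rightarrow> ('g, 'm) monoid_scheme \<Rightarrow> (('g \<Rightarrow> nat) \<times> ('g \<Rightarrow> nat)) set" where
  "orbit_equivalence S G =
     {(x, y). x \<in> topspace (power_space S (carrier G)) \<and> (\<exists>g\<in>carrier G. y = shift G g x)}"

definition invariant_under :: "('a \<times> 'a) set \<Rightarrow> 'a set \<Rightarrow> bool" where
  "invariant_under E A \<longleftrightarrow> (\<forall>(x, y)\<in>E. x \<in> A \<longleftrightarrow> y \<in> A)"

definition enumeration :: "('g, 'm) monoid_scheme \<Rightarrow> (nat \<Rightarrow> 'g) \<Rightarrow> bool" where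
  "enumeration G \<pi> \<longleftrightarrow> bij_betw \<pi> UNIV (carrier G)"

text \<open>
  For an enumeration \<open>\<pi>\<close> of \<open>G\<close>, \<open>y = induced_map G \<pi> x\<close> is the element of the power
  over \<open>carrier G\<close> with \<open>y (\<pi> n) = x n\<close> for all \<open>n\<close>.
\<close>

definition induced_map ::
    "('g, 'm) monoid_scheme \<Rightarrow> (nat \<Rightarrow> 'g) \<Rightarrow> (nat \<Rightarrow> nat) \<Rightarrow> 'g \<Rightarrow> nat" where
  "induced_map G \<pi> x = (\<lambda>h\<in>carrier G. x (inv_into UNIV \<pi> h))"

text \<open>
  A strategy maps finite positions (all moves played so far, by both players) to moves in \<open>S\<close>.
  Player I moves at even stages, player II at odd stages.
\<close>

definition strategy :: "nat set \<Rightarrow> (nat list \<Rightarrow> nat) \<Rightarrow> bool" where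
  "strategy S \<sigma> \<longleftrightarrow> (\<forall>p\<in>lists S. \<sigma> p \<in> S)"

definition winning_for_I :: "nat set \<Rightarrow> (nat \<Rightarrow> nat) set \<Rightarrow> (nat list \<Rightarrow> nat) \<Rightarrow> bool" where
  "winning_for_I S A \<sigma> \<longleftrightarrow> strategy S \<sigma> \<and>
     (\<forall>x. range x \<subseteq> S \<longrightarrow> (\<forall>n. even n \<longrightarrow> x n = \<sigma> (map x [0..<n])) \<longrightarrow> x \<in> A)"

definition winning_for_II :: "nat set \<Rightarrow> (nat \<Rightarrow> nat) set \<Rightarrow> (nat list \<Rightarrow> nat) \<Rightarrow> bool" where
  "winning_for_II S A \<tau> \<longleftrightarrow> strategy S \<tau> \<and>
     (\<forall>x. range x \<subseteq> S \<longrightarrow> (\<forall>n. odd n \<longrightarrow> x n = \<tau> (map x [0..<n])) \<longrightarrow> x \<notin> A)"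

definition determined :: "nat set \<Rightarrow> (nat \<Rightarrow> nat) set \<Rightarrow> bool" where
  "determined S A \<longleftrightarrow> (\<exists>\<sigma>. winning_for_I S A \<sigma>) \<or> (\<exists>\<tau>. winning_for_II S A \<tau>)"

definition pointclass_determinacy :: "nat set \<Rightarrow> set_family \<Rightarrow> bool" where
  "pointclass_determinacy S \<Gamma> \<longleftrightarrow>
     (\<forall>A. in_pointclass \<Gamma> (power_space S (UNIV :: nat set)) A \<longrightarrow> determined S A)"

definition orbit_determinacy ::
    "nat set \<Rightarrow> set_family \<Rightarrow> ('g, 'm) monoid_scheme \<Rightarrow> bool" where
  "orbit_determinacy S \<Gamma> G \<longleftrightarrow>
     (\<forall>A \<pi>. in_pointclass \<Gamma> (power_space S (carrier G)) A \<longrightarrow>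
        invariant_under (orbit_equivalence S G) A \<longrightarrow>
        enumeration G \<pi> \<longrightarrow>
        determined S {x \<in> topspace (power_space S UNIV). induced_map G \<pi> x \<in> A})"

end

theory Submission
  imports Defs
begin

text \<open>
  Enumerate \<open>G\<close> so that the two players make the moves of the original game at times \<open>0, 1\<close>
  modulo 4, while at times \<open>2\<close> (player I) and \<open>3\<close> (player II) modulo 4 they are expected to play
  prescribed bits. The prescription is chosen so that for every \<open>h \<noteq> 1\<close> each player's prescribed
  bits contradict both players' prescriptions translated by \<open>h\<close>. Hence as soon as one player obeys, no
  nontrivial translate of the outcome obeys any prescription: the orbit of the outcome remembers
  the origin of the play, and also whether the other player obeyed. Let player I win if some translate
  of the outcome obeys both prescriptions and has its free part in \<open>A\<close>, or if some translate obeys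
  the prescription of I and none obeys that of II. This payoff is invariant, and disobeying
  loses against an obedient opponent, so the game is equivalent to the one for \<open>A\<close>. Since the origin
  is unique, the payoff set comes from \<open>A\<close> by a \<open>\<Delta>\<^sup>0\<^sub>3\<close>-measurable
  substitution and Boolean operations with \<open>\<Delta>\<^sup>0\<^sub>3\<close> sets.
\<close>

section \<open>Low levels of the Borel hierarchy\<close>

lemma Sigma0_SucI:
  assumes "\<And>k::nat. B k \<in> Pi0 X (Suc n)"
  shows "(\<Union>k. B k) \<in> Sigma0 X (Suc (Suc n))"
  using assms by (auto simp: Pi0_def)

lemma fsigma_in_imp_Sigma0: "fsigma_in X F \<Longrightarrow> F \<in> Sigma0 X 2"
proof -
  assume "fsigma_in X F"
  then obtain C :: "nat \<Rightarrow> _" where C: "\<forall>n. closedin X (C n)" "\<Union> (range C) = F"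
    unfolding fsigma_in_ascending by metis
  have "(\<Union>k. C k) \<in> Sigma0 X (Suc (Suc 0))"
    by (rule Sigma0_SucI) (use C in \<open>auto simp: Pi0_def closedin_def\<close>)
  with C show ?thesis by (simp add: numeral_2_eq_2)
qed

lemma gdelta_in_imp_Pi0: "gdelta_in X F \<Longrightarrow> F \<in> Pi0 X 2"
  by (simp add: Pi0_def gdelta_in_fsigma_in fsigma_in_imp_Sigma0)

text \<open>Metrizability enters at the bottom level, where open sets are F-sigma; higher levels
  follow by passing to complements.\<close>

lemma Sigma0_mono_Suc:
  assumes "metrizable_space X" "0 < n" "A \<in> Sigma0 X n"
  shows "A \<in> Sigma0 X (Suc n)"
  using assms
proof (induction X n arbitrary: A rule: Sigma0.induct)
  case (2 X)
  then show ?case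
    using fsigma_in_imp_Sigma0[OF open_imp_fsigma_in] by (simp add: numeral_2_eq_2 del: Sigma0.simps(3))
next
  case (3 X n)
  from 3(4) obtain B :: "nat \<Rightarrow> _" where B: "A = (\<Union>k. B k)" "\<And>k. B k \<in> Pi0 X (Suc n)"
    by (auto simp: Pi0_def)
  have "B k \<in> Pi0 X (Suc (Suc n))" for k
    using B(2)[of k] 3 by (auto simp: Pi0_def simp del: Sigma0.simps(3))
  then show ?case unfolding B(1) by (rule Sigma0_SucI)
qed simp

lemma Sigma0_mono:
  assumes "metrizable_space X" "0 < m" "m \<le> n" "A \<in> Sigma0 X m"
  shows "A \<in> Sigma0 X n"
  using assms(3)
proof (induction n rule: dec_induct)
  case base
  show ?case by (fact assms(4))
next
  case (step n)
  then show ?case using assms Sigma0_mono_Suc by (meson less_le_trans)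
qed

lemma Delta0_mono:
  assumes "metrizable_space X" "0 < m" "m \<le> n" "A \<in> Delta0 X m"
  shows "A \<in> Delta0 X n"
  using assms Sigma0_mono unfolding Delta0_def Pi0_def by blast

text \<open>Write \<open>F\<close> as a countable union of closed sets \<open>C k\<close>. Each
  \<open>C k \<inter> D\<close> is again G-delta, and a countable union of such sets lies at level
  3.\<close>

lemma fsigma_Int_gdelta_in_Sigma0:
  assumes "metrizable_space X" "fsigma_in X F" "gdelta_in X D"
  shows "F \<inter> D \<in> Sigma0 X 3"
proof -
  obtain C :: "nat \<Rightarrow> _" where C: "\<forall>n. closedin X (C n)" "\<Union> (range C) = F"
    using assms(2) unfolding fsigma_in_ascending by metis
  have "(\<Union>k. C k \<inter> D) \<in> Sigma0 X (Suc (Suc (Suc 0)))"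
    by (rule Sigma0_SucI, unfold numeral_2_eq_2[symmetric], intro gdelta_in_imp_Pi0 gdelta_in_Int)
      (use C assms closed_imp_gdelta_in in auto)
  moreover have "(\<Union>k. C k \<inter> D) = F \<inter> D" using C by auto
  ultimately show ?thesis by (simp add: numeral_3_eq_3 del: Sigma0.simps)
qed

lemma fsigma_Un_gdelta_in_Sigma0:
  assumes "metrizable_space X" "fsigma_in X F" "gdelta_in X D"
  shows "F \<union> D \<in> Sigma0 X 3"
proof -
  obtain C :: "nat \<Rightarrow> _" where C: "\<forall>n. closedin X (C n)" "\<Union> (range C) = F"
    using assms(2) unfolding fsigma_in_ascending by metis
  have "(\<Union>k. C k \<union> D) \<in> Sigma0 X (Suc (Suc (Suc 0)))"
    by (rule Sigma0_SucI, unfold numeral_2_eq_2[symmetric], intro gdelta_in_imp_Pi0 gdelta_in_Un)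
      (use C assms closed_imp_gdelta_in in auto)
  moreover have "(\<Union>k. C k \<union> D) = F \<union> D" using C by auto
  ultimately show ?thesis by (simp add: numeral_3_eq_3 del: Sigma0.simps)
qed

text \<open>By De Morgan the complement is the union of a G-delta and an F-sigma set, so the lemma
  on unions supplies the dual half.\<close>

lemma fsigma_Int_gdelta_in_Delta0:
  assumes "metrizable_space X" "fsigma_in X F" "gdelta_in X D"
  shows "F \<inter> D \<in> Delta0 X 3"
proof -
  have "(topspace X - D) \<union> (topspace X - F) \<in> Sigma0 X 3"
    using assms fsigma_Un_gdelta_in_Sigma0 fsigma_in_gdelta_in gdelta_in_fsigma_in by blast
  moreover have "(topspace X - D) \<union> (topspace X - F) = topspace X - F \<inter> D" by auto
  ultimately show ?thesis
    using fsigma_Int_gdelta_in_Sigma0[OF assms] gdelta_in_subset[OF assms(3)]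
    by (simp add: Delta0_def Pi0_def le_infI2)
qed

lemma fsigma_Un_gdelta_in_Delta0:
  assumes "metrizable_space X" "fsigma_in X F" "gdelta_in X D"
  shows "F \<union> D \<in> Delta0 X 3"
proof -
  have "(topspace X - D) \<inter> (topspace X - F) \<in> Sigma0 X 3"
    using assms fsigma_Int_gdelta_in_Sigma0 fsigma_in_gdelta_in gdelta_in_fsigma_in by blast
  moreover have "(topspace X - D) \<inter> (topspace X - F) = topspace X - (F \<union> D)" by auto
  ultimately show ?thesis
    using fsigma_Un_gdelta_in_Sigma0[OF assms] fsigma_in_subset[OF assms(2)] gdelta_in_subset[OF assms(3)]
    by (simp add: Delta0_def Pi0_def)
qed

text \<open>The maps \<open>\<phi> i\<close> on the disjoint closed pieces glue to a single
  \<open>\<Delta>\<^sup>0\<^sub>3\<close>-measurable substitution. This is how a payoff whose origin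
  \<open>i\<close> must be located inside the play stays in \<open>\<Gamma>\<close>.\<close>

lemma reasonable_pointclass_piecewise:
  assumes \<Gamma>: "reasonable_pointclass \<Gamma>" and X: "polish_topology X" and A: "A \<in> \<Gamma> Y"
    and z0: "z0 \<in> topspace Y" and I: "countable I"
    and K: "\<And>i. i \<in> I \<Longrightarrow> closedin X (K i)"
    and disj: "\<And>i j x. i \<in> I \<Longrightarrow> j \<in> I \<Longrightarrow> x \<in> K i \<Longrightarrow> x \<in> K j \<Longrightarrow> i = j"
    and \<phi>: "\<And>i. i \<in> I \<Longrightarrow> continuous_map X Y (\<phi> i)"
    and D: "D \<in> Delta0 X 6"
  shows "{x \<in> topspace X. \<exists>i\<in>I. x \<in> K i \<and> \<phi> i x \<in> A} \<union> D \<in> \<Gamma> X"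
proof -
  have mX: "metrizable_space X"
    using X completely_metrizable_imp_metrizable_space by (auto simp: polish_topology_def)
  define U where "U = (\<Union>i\<in>I. K i)"
  \<comment> \<open>Disjointness makes the index unique; off the pieces \<open>f\<close> takes the
    arbitrary constant value \<open>z0\<close>.\<close>
  define f where "f x = (if x \<in> U then \<phi> (THE i. i \<in> I \<and> x \<in> K i) x else z0)" for x
  have f: "f x = \<phi> i x" if "i \<in> I" "x \<in> K i" for i x
  proof -
    have "(THE i. i \<in> I \<and> x \<in> K i) = i"
      by (rule the_equality) (use that disj in auto)
    with that show ?thesis by (auto simp: f_def U_def)
  qed
  have U: "fsigma_in X U"
    unfolding U_def by (rule fsigma_in_Union) (use I K closed_imp_fsigma_in in auto)
  have Usub: "U \<subseteq> topspace X" using U by (rule fsigma_in_subset)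
  have "Delta0_measurable_map 6 X Y f"
    unfolding Delta0_measurable_map_def
  proof (intro conjI allI impI)
    show "f \<in> topspace X \<rightarrow> topspace Y"
    proof
      fix x assume x: "x \<in> topspace X"
      show "f x \<in> topspace Y"
      proof (cases "x \<in> U")
        case True
        then obtain i where i: "i \<in> I" "x \<in> K i" by (auto simp: U_def)
        then have "\<phi> i x \<in> topspace Y"
          using \<phi>[OF i(1)] x by (auto simp: continuous_map_def)
        with f[OF i] show ?thesis by simp
      qed (simp add: f_def z0)
    qed
  next
    fix V assume V: "openin Y V"
    \<comment> \<open>The part of the preimage inside the pieces is a countable union of closed sets
      cut with open ones, hence F-sigma. Outside, \<open>f\<close> is constant, so the G-delta
      complement of \<open>U\<close> is added entirely or not at all.\<close>
    define F where "F = (\<Union>i\<in>I. K i \<inter> {x \<in> topspace X. \<phi> i x \<in> V})"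
    have "fsigma_in X F"
      unfolding F_def
    proof (rule fsigma_in_Union)
      fix E assume "E \<in> (\<lambda>i. K i \<inter> {x \<in> topspace X. \<phi> i x \<in> V}) ` I"
      then obtain i where i: "i \<in> I" "E = K i \<inter> {x \<in> topspace X. \<phi> i x \<in> V}" by auto
      have "openin X {x \<in> topspace X. \<phi> i x \<in> V}"
        using \<phi>[OF i(1)] V by (auto simp: continuous_map_def)
      then show "fsigma_in X E"
        unfolding i(2) by (intro fsigma_in_Int closed_imp_fsigma_in open_imp_fsigma_in K i mX)
    qed (use I in auto)
    moreover have "f -` V \<inter> topspace X = F \<union> (if z0 \<in> V then topspace X - U else {})"
    proof (rule Set.set_eqI)
      fix x
      show "x \<in> f -` V \<inter> topspace X \<longleftrightarrow> x \<in> F \<union> (if z0 \<in> V then topspace X - U else {})"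
      proof (cases "x \<in> U")
        case True
        then obtain i where i: "i \<in> I" "x \<in> K i" by (auto simp: U_def)
        then have "x \<in> F \<longleftrightarrow> \<phi> i x \<in> V" using disj Usub True by (auto simp: F_def)
        then show ?thesis using f[OF i] True Usub by auto
      next
        case False
        then show ?thesis by (auto simp: F_def U_def f_def)
      qed
    qed
    moreover have "gdelta_in X (if z0 \<in> V then topspace X - U else {})"
      using U by (simp add: fsigma_in_gdelta_in)
    ultimately have "f -` V \<inter> topspace X \<in> Delta0 X 3"
      using fsigma_Un_gdelta_in_Delta0[OF mX] by metis
    then show "f -` V \<inter> topspace X \<in> Delta0 X 6"
      by (rule Delta0_mono[OF mX, rotated 2]) auto
  qed
  then have 1: "f -` A \<inter> topspace X \<in> \<Gamma> X"
    using \<Gamma> X A unfolding reasonable_pointclass_def by blast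
  \<comment> \<open>Intersecting with \<open>U\<close> discards the points that enter the preimage
    only because \<open>z0\<close> may lie in \<open>A\<close>.\<close>
  have "U \<inter> topspace X \<in> Delta0 X 3"
    by (rule fsigma_Int_gdelta_in_Delta0) (use U mX in auto)
  then have "U \<inter> topspace X \<in> Delta0 X 6"
    by (rule Delta0_mono[OF mX, rotated 2]) auto
  then have "(f -` A \<inter> topspace X) \<inter> (U \<inter> topspace X) \<union> D \<in> \<Gamma> X"
    using \<Gamma> 1 D unfolding reasonable_pointclass_def by blast
  moreover have "(f -` A \<inter> topspace X) \<inter> (U \<inter> topspace X)
      = {x \<in> topspace X. \<exists>i\<in>I. x \<in> K i \<and> \<phi> i x \<in> A}"
    using f by (auto simp: U_def)
  ultimately show ?thesis by simp
qed

section \<open>A self-avoiding colouring of the group\<close>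

text \<open>There are countably many requirements \<open>(h, a, b)\<close>. Each gets its own pair
  of points \<open>g\<close> and \<open>h \<otimes> g\<close>, disjoint from all earlier pairs, so
  the values on different pairs never conflict.\<close>

lemma (in group) exists_self_avoiding_colouring:
  assumes "countable (carrier G)" "infinite (carrier G)"
  shows "\<exists>T C. \<forall>h\<in>carrier G - {\<one>}. \<forall>a<4::nat. \<forall>b<4::nat. \<exists>g\<in>carrier G.
    T (h \<otimes> g) = a \<and> T g = b \<and> C (h \<otimes> g) = (0::nat) \<and> C g = 1"
proof -
  define Q where "Q = (carrier G - {\<one>}) \<times> {..<4::nat} \<times> {..<4::nat}"
  have ne: "carrier G - {\<one>} \<noteq> {}"
    using assms(2) by (metis finite.emptyI finite_Diff2 finite_insert)
  then have Q: "countable Q" "Q \<noteq> {}"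
    using assms(1) by (auto simp: Q_def lessThan_empty_iff)
  define e where "e = from_nat_into Q"
  have e: "range e = Q" unfolding e_def using Q by simp
  define H where "H k = fst (e k)" for k
  have H: "H k \<in> carrier G" "H k \<noteq> \<one>" for k
    using rangeI[of e k] unfolding e by (auto simp: H_def Q_def mem_Times_iff)
  have "\<exists>u. \<forall>k. u k \<in> carrier G \<and> (\<forall>j<k. {u k, H k \<otimes> u k} \<inter> {u j, H j \<otimes> u j} = {})"
  proof (rule dependent_wellorder_choice
      [where P = "\<lambda>u k r. r \<in> carrier G \<and> (\<forall>j<k. {r, H k \<otimes> r} \<inter> {u j, H j \<otimes> u j} = {})"])
    fix k :: nat and f
    assume IH: "\<And>j. j < k \<Longrightarrow> f j \<in> carrier G \<and>
      (\<forall>i<j. {f j, H j \<otimes> f j} \<inter> {f i, H i \<otimes> f i} = {})"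
    define F where "F = (\<Union>j<k. {f j, H j \<otimes> f j})"
    \<comment> \<open>Avoiding \<open>F\<close> makes \<open>r\<close> new; avoiding its translate
      makes \<open>H k \<otimes> r\<close> new. Only finitely many points are forbidden, and the
      group is infinite.\<close>
    have "finite (F \<union> (\<lambda>x. inv (H k) \<otimes> x) ` F)" by (simp add: F_def)
    then obtain r where r: "r \<in> carrier G" "r \<notin> F" "r \<notin> (\<lambda>x. inv (H k) \<otimes> x) ` F"
      using assms(2) by (metis UnCI finite_subset subsetI)
    have "H k \<otimes> r \<notin> F"
    proof
      assume "H k \<otimes> r \<in> F"
      then have "inv (H k) \<otimes> (H k \<otimes> r) \<in> (\<lambda>x. inv (H k) \<otimes> x) ` F" by blast
      then show False using r H[of k] by (simp add: m_assoc[symmetric])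
    qed
    with r show "\<exists>r. r \<in> carrier G \<and> (\<forall>j<k. {r, H k \<otimes> r} \<inter> {f j, H j \<otimes> f j} = {})"
      by (intro exI[of _ r]) (auto simp: F_def)
  qed auto
  then obtain u where u: "\<And>k. u k \<in> carrier G"
    and sep: "\<And>j k. j < k \<Longrightarrow> {u k, H k \<otimes> u k} \<inter> {u j, H j \<otimes> u j} = {}" by metis
  define v where "v k = H k \<otimes> u k" for k
  have sep': "{u k, v k} \<inter> {u j, v j} = {}" if "j \<noteq> k" for j k
    using sep[of j k] sep[of k j] that unfolding v_def by (metis inf_commute nat_neq_iff)
  have inj: "inj u" "inj v"
    using sep' by (auto simp: inj_def)
  \<comment> \<open>Within one pair the two points differ because \<open>H k\<close> is not the
    identity.\<close>
  have "u k \<noteq> v k" for k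
    using H[of k] u[of k] by (simp add: v_def)
  then have uv: "v k \<notin> range u" for k
    using sep' by (metis disjoint_iff insertI1 insertI2 rangeE)
  \<comment> \<open>For \<open>e k = (h, a, b)\<close> the type is \<open>b\<close> at
    \<open>u k\<close> and \<open>a\<close> at \<open>v k\<close>; the values away from all pairs
    are arbitrary.\<close>
  define T where "T x = (if x \<in> range u then snd (snd (e (inv_into UNIV u x)))
    else fst (snd (e (inv_into UNIV v x))))" for x
  define C where "C x = (if x \<in> range u then 1 else 0::nat)" for x
  show ?thesis
  proof (rule exI[of _ T], rule exI[of _ C], intro ballI allI impI)
    fix h a b assume "h \<in> carrier G - {\<one>}" "a < (4::nat)" "b < (4::nat)"
    then have "(h, a, b) \<in> range e" by (simp add: e Q_def)
    then obtain k where k: "e k = (h, a, b)" by auto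
    then have "h \<otimes> u k = v k" by (simp add: v_def H_def)
    then show "\<exists>g\<in>carrier G. T (h \<otimes> g) = a \<and> T g = b \<and> C (h \<otimes> g) = 0 \<and> C g = 1"
      using k u[of k] uv[of k] inj by (intro bexI[of _ "u k"]) (auto simp: T_def C_def)
  qed
qed

text \<open>The elements of type \<open>a\<close> are listed at the times congruent to
  \<open>a\<close> modulo 4, and the colour of an element becomes the bit prescribed at its
  time.\<close>

lemma (in group) exists_self_avoiding_enumeration:
  assumes "countable (carrier G)" "infinite (carrier G)"
  shows "\<exists>\<pi> c. enumeration G \<pi> \<and> (\<forall>n. c n \<in> {0, 1 :: nat}) \<and>
    (\<forall>h\<in>carrier G - {\<one>}. \<forall>a<4. \<forall>b<4. \<exists>m n. m mod 4 = a \<and> n mod 4 = b \<and>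
       \<pi> m = h \<otimes> \<pi> n \<and> c m \<noteq> c n)"
proof -
  obtain T C where TC: "\<And>h a b. h \<in> carrier G - {\<one>} \<Longrightarrow> a < 4 \<Longrightarrow> b < (4::nat) \<Longrightarrow>
      \<exists>g\<in>carrier G. T (h \<otimes> g) = a \<and> T g = b \<and> C (h \<otimes> g) = (0::nat) \<and> C g = 1"
    using exists_self_avoiding_colouring[OF assms] by metis
  \<comment> \<open>Types outside the range 0 to 3 are moved to class 0, so the four classes
    partition the group.\<close>
  define L where "L a = {x \<in> carrier G. (if T x < 4 then T x else 0) = a}" for a
  have inf: "infinite (L a)" if "a < 4" for a
  proof
    assume fin: "finite (L a)"
    \<comment> \<open>With \<open>b = a\<close>, every nontrivial \<open>h\<close> is a quotient of
      two elements of \<open>L a\<close>, so a finite class would make the group finite.\<close>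
    have "carrier G - {\<one>} \<subseteq> (\<lambda>(x, y). x \<otimes> inv y) ` (L a \<times> L a)"
    proof
      fix h assume h: "h \<in> carrier G - {\<one>}"
      then obtain g where g: "g \<in> carrier G" "T (h \<otimes> g) = a" "T g = a"
        using TC[OF h \<open>a < 4\<close> \<open>a < 4\<close>] by auto
      then have "h = (h \<otimes> g) \<otimes> inv g" using h by (simp add: m_assoc)
      moreover have "(h \<otimes> g, g) \<in> L a \<times> L a" using g h that by (simp add: L_def)
      ultimately show "h \<in> (\<lambda>(x, y). x \<otimes> inv y) ` (L a \<times> L a)"
        by (metis (mono_tags, lifting) case_prod_conv image_eqI)
    qed
    then have "finite (carrier G - {\<one>})" using fin by (meson finite_SigmaI finite_imageI finite_subset)
    then show False using assms(2) by simp
  qed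
  define \<beta> where "\<beta> a = from_nat_into (L a)" for a
  have \<beta>: "bij_betw (\<beta> a) UNIV (L a)" if "a < 4" for a
    unfolding \<beta>_def using inf[OF that] assms(1)
    by (intro bij_betw_from_nat_into) (auto simp: L_def intro: countable_subset)
  define \<pi> where "\<pi> n = \<beta> (n mod 4) (n div 4)" for n :: nat
  have \<pi>L: "\<pi> n \<in> L (n mod 4)" for n
    using \<beta>[of "n mod 4"] by (auto simp: \<pi>_def bij_betw_def)
  have "inj \<pi>"
  proof (rule injI)
    fix m n assume eq: "\<pi> m = \<pi> n"
    then have "m mod 4 = n mod 4" using \<pi>L[of m] \<pi>L[of n] by (simp add: L_def)
    moreover from this have "m div 4 = n div 4"
      using eq \<beta>[of "n mod 4"] by (auto simp: \<pi>_def bij_betw_def inj_def)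
    ultimately show "m = n" by (metis div_mult_mod_eq)
  qed
  have surj: "\<exists>n. x = \<pi> n \<and> n mod 4 = a" if x: "x \<in> L a" and a: "a < 4" for x a
  proof -
    obtain k where "x = \<beta> a k" using \<beta>[OF a] x by (auto simp: bij_betw_def)
    then show ?thesis using a by (intro exI[of _ "4 * k + a"]) (simp add: \<pi>_def)
  qed
  have "range \<pi> = carrier G"
  proof
    show "range \<pi> \<subseteq> carrier G" using \<pi>L by (auto simp: L_def)
    show "carrier G \<subseteq> range \<pi>"
    proof
      fix x assume "x \<in> carrier G"
      then have "x \<in> L (if T x < 4 then T x else 0)" by (simp add: L_def)
      then show "x \<in> range \<pi>" using surj by (metis rangeI zero_less_numeral)
    qed
  qed
  with \<open>inj \<pi>\<close> have "enumeration G \<pi>" by (simp add: enumeration_def bij_betw_def)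
  moreover have "\<exists>m n. m mod 4 = a \<and> n mod 4 = b \<and> \<pi> m = h \<otimes> \<pi> n \<and>
      (if C (\<pi> m) = 0 then 0 else 1::nat) \<noteq> (if C (\<pi> n) = 0 then 0 else 1)"
    if h: "h \<in> carrier G - {\<one>}" and "a < 4" "b < 4" for h a b
  proof -
    obtain g where g: "g \<in> carrier G" "T (h \<otimes> g) = a" "T g = b" "C (h \<otimes> g) = 0" "C g = 1"
      using TC[OF h \<open>a < 4\<close> \<open>b < 4\<close>] by auto
    then have "h \<otimes> g \<in> L a" "g \<in> L b" using that by (auto simp: L_def)
    from surj[OF this(1) \<open>a < 4\<close>] surj[OF this(2) \<open>b < 4\<close>]
    obtain m n where "h \<otimes> g = \<pi> m" "m mod 4 = a" "g = \<pi> n" "n mod 4 = b" by blast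
    then show ?thesis using g by (intro exI[of _ m] exI[of _ n]) auto
  qed
  ultimately show ?thesis
    by (intro exI[of _ \<pi>] exI[of _ "\<lambda>n. if C (\<pi> n) = 0 then 0 else 1"]) auto
qed

section \<open>Games with forced moves\<close>

text \<open>
  In the game with forced moves, the moves at times \<open>n\<close> with \<open>n mod 4 \<in> {0, 1}\<close> are those
  of the original game; \<open>free_time m\<close> is the time of the original move \<open>m\<close>, and has the same
  parity as \<open>m\<close>.
\<close>

definition free_time :: "nat \<Rightarrow> nat" where
  "free_time m = 4 * (m div 2) + m mod 2"

text \<open>Left inverse of \<open>free_time\<close>, consulted only at times with residue 0 or 1
  modulo 4.\<close>

definition free_index :: "nat \<Rightarrow> nat" where
  "free_index n = 2 * (n div 4) + n mod 4"

lemma free_time_div_mod_4: "free_time m div 4 = m div 2" "free_time m mod 4 = m mod 2"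
  by (cases "even m"; auto simp: free_time_def odd_iff_mod_2_eq_one)+

lemma free_time_mod_2 [simp]: "free_time m mod 2 = m mod 2"
  by (simp add: free_time_def mod2_eq_if)

lemma free_time_mod_4_less [simp]: "free_time m mod 4 < 2"
  by (simp add: free_time_div_mod_4)

lemma free_index_free_time [simp]: "free_index (free_time m) = m"
  by (simp add: free_index_def free_time_div_mod_4)

lemma free_index_less:
  assumes "n < free_time m" "n mod 4 < 2"
  shows "free_index n < m"
proof -
  have "4 * (n div 4) + n mod 4 < 4 * (m div 2) + m mod 2" "m = 2 * (m div 2) + m mod 2" "m mod 2 < 2"
    using assms(1) by (simp_all add: free_time_def)
  then show ?thesis
    using assms(2) unfolding free_index_def by (cases "n div 4 < m div 2") linarith+
qed

primrec history :: "(nat \<Rightarrow> nat list \<Rightarrow> nat) \<Rightarrow> nat \<Rightarrow> nat list" where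
  "history F 0 = []"
| "history F (Suc n) = history F n @ [F n (history F n)]"

lemma map_history: "map (\<lambda>k. F k (history F k)) [0..<n] = history F n"
  by (induction n) auto

lemma history_cong: "(\<And>k q. k < n \<Longrightarrow> F k q = F' k q) \<Longrightarrow> history F n = history F' n"
  by (induction n) auto

lemma history_in_lists:
  "(\<And>k q. k < n \<Longrightarrow> q \<in> lists S \<Longrightarrow> F k q \<in> S) \<Longrightarrow> history F n \<in> lists S"
  by (induction n) auto

text \<open>Here \<open>b\<close> is the parity of the player following \<open>\<sigma>\<close>. The
  long play is simulated: this player uses \<open>\<sigma>\<close> at all own times, the opponent's
  free moves come from \<open>z\<close>, and the opponent's forced moves are played as prescribed by
  \<open>c\<close>.\<close>

lemma strategy_without_forced_moves:
  assumes \<sigma>: "strategy S \<sigma>" and S: "0 \<in> S" and c: "\<And>n. c n \<in> S"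
  shows "\<exists>\<sigma>'. strategy S \<sigma>' \<and>
    (\<forall>z. range z \<subseteq> S \<longrightarrow> (\<forall>n. n mod 2 = b \<longrightarrow> z n = \<sigma>' (map z [0..<n])) \<longrightarrow>
      (\<exists>x. range x \<subseteq> S \<and> (\<forall>n. n mod 2 = b \<longrightarrow> x n = \<sigma> (map x [0..<n])) \<and> x \<circ> free_time = z \<and>
        (\<forall>n. n mod 2 \<noteq> b \<longrightarrow> \<not> n mod 4 < 2 \<longrightarrow> x n = c n)))"
proof -
  define M where "M z n q =
    (if n mod 2 = b then \<sigma> q else if n mod 4 < 2 then z (free_index n) else c n)" for z n q
  \<comment> \<open>The position \<open>p\<close> is padded with 0 to an infinite sequence. The
    padding is never read: by \<open>free_index_less\<close> the simulation up to
    \<open>free_time (length p)\<close> uses only entries of \<open>p\<close>.\<close>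
  define \<sigma>' where "\<sigma>' p =
    \<sigma> (history (M (\<lambda>i. if i < length p then p ! i else 0)) (free_time (length p)))" for p
  have M: "M z n q \<in> S" if "range z \<subseteq> S" "q \<in> lists S" for z n q
    using that \<sigma> c by (auto simp: M_def strategy_def)
  show ?thesis
  proof (intro exI[of _ \<sigma>'] conjI allI impI)
    show "strategy S \<sigma>'"
      unfolding strategy_def
    proof
      fix p assume p: "p \<in> lists S"
      have "range (\<lambda>i. if i < length p then p ! i else 0) \<subseteq> S"
        using p S by (auto simp: in_lists_conv_set)
      then have "history (M (\<lambda>i. if i < length p then p ! i else 0)) (free_time (length p)) \<in> lists S"
        by (intro history_in_lists M)
      then show "\<sigma>' p \<in> S" using \<sigma> by (auto simp: \<sigma>'_def strategy_def)
    qed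
  next
    fix z assume z: "range z \<subseteq> S" "\<forall>n. n mod 2 = b \<longrightarrow> z n = \<sigma>' (map z [0..<n])"
    define x where "x n = M z n (history (M z) n)" for n
    have x: "map x [0..<n] = history (M z) n" for n
      using map_history[of "M z" n] by (simp add: x_def[abs_def])
    have "x (free_time m) = z m" for m
    proof (cases "m mod 2 = b")
      case True
      have "history (M (\<lambda>i. if i < length (map z [0..<m]) then map z [0..<m] ! i else 0)) (free_time m)
          = history (M z) (free_time m)"
        by (rule history_cong) (auto simp: M_def free_index_less)
      then show ?thesis using True z(2) by (simp add: x_def M_def \<sigma>'_def)
    qed (simp add: x_def M_def)
    moreover have "range x \<subseteq> S"
      using M[OF z(1) history_in_lists] M[OF z(1)] by (auto simp: x_def)
    moreover have "x n = \<sigma> (map x [0..<n])" if "n mod 2 = b" for n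
      using that unfolding x by (simp add: x_def M_def)
    moreover have "x n = c n" if "n mod 2 \<noteq> b" "\<not> n mod 4 < 2" for n
      using that by (simp add: x_def M_def)
    ultimately show "\<exists>x. range x \<subseteq> S \<and> (\<forall>n. n mod 2 = b \<longrightarrow> x n = \<sigma> (map x [0..<n])) \<and>
        x \<circ> free_time = z \<and> (\<forall>n. n mod 2 \<noteq> b \<longrightarrow> \<not> n mod 4 < 2 \<longrightarrow> x n = c n)"
      by (intro exI[of _ x]) (auto simp: comp_def)
  qed
qed

definition obeys :: "(nat \<Rightarrow> nat) \<Rightarrow> nat \<Rightarrow> (nat \<Rightarrow> nat) \<Rightarrow> bool" where
  "obeys c a x \<longleftrightarrow> (\<forall>n. n mod 4 = a \<longrightarrow> x n = c n)"

text \<open>The simulated opponent always obeys. So a win for I in \<open>B\<close> has to be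
  transferred only for plays in which II obeys, and a win for II only for plays in which I
  obeys.\<close>

lemma determined_without_forced_moves:
  assumes det: "determined S B" and S: "0 \<in> S" and c: "\<And>n. c n \<in> S"
    and I: "\<And>x. range x \<subseteq> S \<Longrightarrow> obeys c 3 x \<Longrightarrow> x \<in> B \<Longrightarrow> x \<circ> free_time \<in> A"
    and II: "\<And>x. range x \<subseteq> S \<Longrightarrow> obeys c 2 x \<Longrightarrow> x \<notin> B \<Longrightarrow> x \<circ> free_time \<notin> A"
  shows "determined S A"
  using det unfolding determined_def
proof (elim disjE exE)
  fix \<sigma> assume \<sigma>: "winning_for_I S B \<sigma>"
  then have "strategy S \<sigma>" by (simp add: winning_for_I_def)
  from strategy_without_forced_moves[where b = 0 and c = c, OF this S c]
  obtain \<sigma>' where \<sigma>': "strategy S \<sigma>'"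
    "\<forall>z. range z \<subseteq> S \<longrightarrow> (\<forall>n. n mod 2 = 0 \<longrightarrow> z n = \<sigma>' (map z [0..<n])) \<longrightarrow>
      (\<exists>x. range x \<subseteq> S \<and> (\<forall>n. n mod 2 = 0 \<longrightarrow> x n = \<sigma> (map x [0..<n])) \<and> x \<circ> free_time = z \<and>
        (\<forall>n. n mod 2 \<noteq> 0 \<longrightarrow> \<not> n mod 4 < 2 \<longrightarrow> x n = c n))"
    by blast
  have "winning_for_I S A \<sigma>'"
    unfolding winning_for_I_def
  proof (intro conjI allI impI \<sigma>'(1))
    fix z assume "range z \<subseteq> S" "\<forall>n. even n \<longrightarrow> z n = \<sigma>' (map z [0..<n])"
    then obtain x where x: "range x \<subseteq> S" "\<forall>n. n mod 2 = 0 \<longrightarrow> x n = \<sigma> (map x [0..<n])"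
      "x \<circ> free_time = z" "\<forall>n. n mod 2 \<noteq> 0 \<longrightarrow> \<not> n mod 4 < 2 \<longrightarrow> x n = c n"
      using \<sigma>'(2)[rule_format, of z] by (auto simp: even_iff_mod_2_eq_zero)
    have "n mod 2 \<noteq> 0 \<and> \<not> n mod 4 < 2" if "n mod 4 = 3" for n :: nat
      using that by presburger
    then have "obeys c 3 x" using x(4) by (auto simp: obeys_def)
    moreover have "x \<in> B"
      using \<sigma> x by (auto simp: winning_for_I_def even_iff_mod_2_eq_zero)
    ultimately show "z \<in> A" using I x by blast
  qed
  then show "(\<exists>\<sigma>. winning_for_I S A \<sigma>) \<or> (\<exists>\<tau>. winning_for_II S A \<tau>)" by blast
next
  fix \<tau> assume \<tau>: "winning_for_II S B \<tau>"
  then have "strategy S \<tau>" by (simp add: winning_for_II_def)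
  from strategy_without_forced_moves[where b = 1 and c = c, OF this S c]
  obtain \<tau>' where \<tau>': "strategy S \<tau>'"
    "\<forall>z. range z \<subseteq> S \<longrightarrow> (\<forall>n. n mod 2 = 1 \<longrightarrow> z n = \<tau>' (map z [0..<n])) \<longrightarrow>
      (\<exists>x. range x \<subseteq> S \<and> (\<forall>n. n mod 2 = 1 \<longrightarrow> x n = \<tau> (map x [0..<n])) \<and> x \<circ> free_time = z \<and>
        (\<forall>n. n mod 2 \<noteq> 1 \<longrightarrow> \<not> n mod 4 < 2 \<longrightarrow> x n = c n))"
    by blast
  have "winning_for_II S A \<tau>'"
    unfolding winning_for_II_def
  proof (intro conjI allI impI \<tau>'(1))
    fix z assume "range z \<subseteq> S" "\<forall>n. odd n \<longrightarrow> z n = \<tau>' (map z [0..<n])"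
    then obtain x where x: "range x \<subseteq> S" "\<forall>n. n mod 2 = 1 \<longrightarrow> x n = \<tau> (map x [0..<n])"
      "x \<circ> free_time = z" "\<forall>n. n mod 2 \<noteq> 1 \<longrightarrow> \<not> n mod 4 < 2 \<longrightarrow> x n = c n"
      using \<tau>'(2)[rule_format, of z] by (auto simp: odd_iff_mod_2_eq_one)
    have "n mod 2 \<noteq> 1 \<and> \<not> n mod 4 < 2" if "n mod 4 = 2" for n :: nat
      using that by presburger
    then have "obeys c 2 x" using x(4) by (auto simp: obeys_def)
    moreover have "x \<notin> B"
      using \<tau> x by (auto simp: winning_for_II_def odd_iff_mod_2_eq_one)
    ultimately show "z \<notin> A" using II x by blast
  qed
  then show "(\<exists>\<sigma>. winning_for_I S A \<sigma>) \<or> (\<exists>\<tau>. winning_for_II S A \<tau>)" by blast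
qed

section \<open>The invariant payoff set\<close>

lemma topspace_power_space_UNIV: "x \<in> topspace (power_space S UNIV) \<longleftrightarrow> range x \<subseteq> S"
  by (auto simp: power_space_def)

lemma continuous_map_reindex:
  "continuous_map (power_space S UNIV) (power_space S UNIV) (\<lambda>x. x \<circ> t)"
  unfolding power_space_def continuous_map_componentwise_UNIV comp_def
  by (auto intro: continuous_map_product_projection)

lemma closedin_obeys_reindex:
  "closedin (power_space S UNIV) {x \<in> topspace (power_space S UNIV). obeys c a (x \<circ> t)}"
proof -
  \<comment> \<open>Intersecting with \<open>S\<close> keeps the set inside the discrete factor,
    where every subset is closed.\<close>
  have cl: "closedin (power_space S UNIV) {x \<in> topspace (power_space S UNIV). x i \<in> {k} \<inter> S}" for i k
    unfolding power_space_def
    by (rule closedin_continuous_map_preimage[where Y = "discrete_topology S"])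
      (auto intro: continuous_map_product_projection)
  have "{x \<in> topspace (power_space S UNIV). obeys c a (x \<circ> t)} = topspace (power_space S UNIV) \<inter>
      (\<Inter>n\<in>{n. n mod 4 = a}. {x \<in> topspace (power_space S UNIV). x (t n) \<in> {c n} \<inter> S})"
    by (auto simp: obeys_def topspace_power_space_UNIV image_subset_iff)
  also have "closedin (power_space S UNIV) \<dots>"
    \<comment> \<open>An intersection over an empty index set is the whole type, so the case of no
      time with residue \<open>a\<close> is separate.\<close>
    by (cases "{n. n mod 4 = a} = {}") (simp, intro closedin_Int closedin_INT closedin_topspace cl)
  finally show ?thesis .
qed

lemma homeomorphic_maps_induced_map:
  assumes "enumeration G \<pi>"
  shows "homeomorphic_maps (power_space S (carrier G)) (power_space S UNIV)
    (\<lambda>y n. y (\<pi> n)) (induced_map G \<pi>)"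
proof -
  have \<pi>: "inj \<pi>" "range \<pi> = carrier G"
    using assms by (auto simp: enumeration_def bij_betw_def)
  have \<pi>': "\<pi> n \<in> carrier G" for n using \<pi>(2) by auto
  show ?thesis
    unfolding homeomorphic_maps_def
  proof (intro conjI ballI)
    show "continuous_map (power_space S (carrier G)) (power_space S UNIV) (\<lambda>y n. y (\<pi> n))"
      unfolding power_space_def continuous_map_componentwise_UNIV
      by (auto intro!: continuous_map_product_projection \<pi>')
    show "continuous_map (power_space S UNIV) (power_space S (carrier G)) (induced_map G \<pi>)"
      unfolding power_space_def continuous_map_componentwise
      by (auto simp: induced_map_def intro!: continuous_map_product_projection)
  next
    fix y assume "y \<in> topspace (power_space S (carrier G))"
    then have y: "y \<in> extensional (carrier G)" by (auto simp: power_space_def PiE_def)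
    show "induced_map G \<pi> (\<lambda>n. y (\<pi> n)) = y"
      by (rule extensionalityI[OF _ y]) (auto simp: induced_map_def \<pi>(2) f_inv_into_f)
  next
    fix x
    show "(\<lambda>n. induced_map G \<pi> x (\<pi> n)) = x"
      using \<pi> \<pi>' by (auto simp: induced_map_def)
  qed
qed

theorem theorem2p3:
  fixes G :: "('g, 'm) monoid_scheme" and S :: "nat set" and \<Gamma> :: set_family
  assumes "group G" and "countable (carrier G)" and "infinite (carrier G)"
    and "S = {0, 1} \<or> S = UNIV"
    and "reasonable_pointclass \<Gamma>"
    and "orbit_determinacy S \<Gamma> G"
  shows "pointclass_determinacy S \<Gamma>"
  unfolding pointclass_determinacy_def
proof (intro allI impI)
  interpret group G by fact
  let ?Z = "power_space S (UNIV :: nat set)" and ?X = "power_space S (carrier G)"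
  fix A assume "in_pointclass \<Gamma> ?Z A"
  moreover have pc: "pointclass \<Gamma>" using assms(5) by (simp add: reasonable_pointclass_def)
  ultimately have A: "A \<in> \<Gamma> ?Z" by (simp add: in_pointclass_iff)
  then have Z: "polish_topology ?Z" using pc by (auto simp: pointclass_def)
  then have mZ: "metrizable_space ?Z"
    using completely_metrizable_imp_metrizable_space by (auto simp: polish_topology_def)
  have S: "0 \<in> S" "1 \<in> S" using assms(4) by auto

  \<comment> \<open>Time indices and translates of a play\<close>
  obtain \<pi> c where \<pi>: "enumeration G \<pi>" and c: "\<And>n. c n \<in> {0, 1 :: nat}"
    and avoid: "\<And>h a b. h \<in> carrier G - {\<one>\<^bsub>G\<^esub>} \<Longrightarrow> a < 4 \<Longrightarrow> b < 4 \<Longrightarrow>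
      \<exists>m n. m mod 4 = a \<and> n mod 4 = b \<and> \<pi> m = h \<otimes>\<^bsub>G\<^esub> \<pi> n \<and> c m \<noteq> c n"
    using exists_self_avoiding_enumeration[OF assms(2,3)] by metis
  have cS: "c n \<in> S" for n using c[of n] S by auto
  have inj\<pi>: "inj \<pi>" and range\<pi>: "range \<pi> = carrier G"
    using \<pi> by (auto simp: enumeration_def bij_betw_def)
  have \<pi>G [simp]: "\<pi> n \<in> carrier G" for n using range\<pi> by auto
  \<comment> \<open>Left multiplication by \<open>h\<close> transported to time indices, so
    \<open>x \<circ> \<tau> h\<close> is a translate of \<open>x\<close> read along
    \<open>\<pi>\<close>.\<close>
  define \<tau> where "\<tau> h n = inv_into UNIV \<pi> (h \<otimes>\<^bsub>G\<^esub> \<pi> n)" for h n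
  have \<pi>\<tau>: "\<pi> (\<tau> h n) = h \<otimes>\<^bsub>G\<^esub> \<pi> n" if "h \<in> carrier G" for h n
    unfolding \<tau>_def by (rule f_inv_into_f) (use that range\<pi> in auto)
  have \<tau>_one [simp]: "\<tau> \<one>\<^bsub>G\<^esub> = id"
    using inj\<pi> by (auto simp: \<tau>_def)
  have \<tau>_mult: "\<tau> g \<circ> \<tau> h = \<tau> (g \<otimes>\<^bsub>G\<^esub> h)" if "g \<in> carrier G" "h \<in> carrier G" for g h
    using that by (intro ext injD[OF inj\<pi>]) (simp add: \<pi>\<tau> m_assoc)
  \<comment> \<open>If \<open>h\<close> were nontrivial, take times with
    \<open>\<tau> h n = m\<close> and \<open>c m \<noteq> c n\<close>. The first obedience gives
    \<open>x m = c m\<close>, the second \<open>x m = c n\<close>.\<close>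
  have only_origin: "h = \<one>\<^bsub>G\<^esub>"
    if h: "h \<in> carrier G" "a < 4" "b < 4" and x: "obeys c a x" "obeys c b (x \<circ> \<tau> h)" for h a b x
  proof (rule ccontr)
    assume "h \<noteq> \<one>\<^bsub>G\<^esub>"
    then obtain m n where mn: "m mod 4 = a" "n mod 4 = b" "\<pi> m = h \<otimes>\<^bsub>G\<^esub> \<pi> n" "c m \<noteq> c n"
      using avoid[of h a b] h by auto
    then have "\<tau> h n = m" using \<pi>\<tau>[OF h(1)] inj\<pi> by (metis injD)
    then show False using x mn by (auto simp: obeys_def)
  qed
  \<comment> \<open>The set of all translates of \<open>y\<close> depends only on the orbit, so any
    condition on \<open>W y\<close> is invariant.\<close>
  define W where "W y = (\<lambda>h n. y (h \<otimes>\<^bsub>G\<^esub> \<pi> n)) ` carrier G" for y :: "'g \<Rightarrow> nat"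
  define win where "win V \<longleftrightarrow> (\<exists>w\<in>V. obeys c 2 w \<and> obeys c 3 w \<and> w \<circ> free_time \<in> A) \<or>
    (\<exists>w\<in>V. obeys c 2 w) \<and> \<not> (\<exists>w\<in>V. obeys c 3 w)" for V
  define B where "B = {y \<in> topspace ?X. win (W y)}"
  define B' where "B' = {x \<in> topspace ?Z. induced_map G \<pi> x \<in> B}"
  have hom: "homeomorphic_maps ?X ?Z (\<lambda>y n. y (\<pi> n)) (induced_map G \<pi>)"
    by (rule homeomorphic_maps_induced_map[OF \<pi>])
  have "(\<lambda>h n. induced_map G \<pi> x (h \<otimes>\<^bsub>G\<^esub> \<pi> n)) ` carrier G = (\<lambda>h. x \<circ> \<tau> h) ` carrier G" for x
    by (intro image_cong ext) (auto simp: induced_map_def \<tau>_def)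
  then have W: "W (induced_map G \<pi> x) = (\<lambda>h. x \<circ> \<tau> h) ` carrier G" for x
    by (simp add: W_def)
  have B': "x \<in> B' \<longleftrightarrow> x \<in> topspace ?Z \<and> win ((\<lambda>h. x \<circ> \<tau> h) ` carrier G)" for x
    using hom by (auto simp: B'_def B_def W homeomorphic_maps_def continuous_map_def)
  have inv: "invariant_under (orbit_equivalence S G) B"
  proof -
    have "shift G g y \<in> B \<longleftrightarrow> y \<in> B" if y: "y \<in> topspace ?X" and g: "g \<in> carrier G" for y g
    proof -
      have "shift G g y \<in> topspace ?X"
        using y g by (auto simp: power_space_def shift_def)
      \<comment> \<open>Shifting by \<open>g\<close> only permutes the translates, through the
        bijection sending \<open>h\<close> to \<open>inv g\<close> times \<open>h\<close>.\<close>
      moreover have "W (shift G g y) = W y"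
      proof -
        have "(\<lambda>n. shift G g y (h \<otimes>\<^bsub>G\<^esub> \<pi> n)) = (\<lambda>n. y ((inv\<^bsub>G\<^esub> g \<otimes>\<^bsub>G\<^esub> h) \<otimes>\<^bsub>G\<^esub> \<pi> n))"
          if "h \<in> carrier G" for h
          using that g by (auto simp: shift_def m_assoc)
        then have "W (shift G g y) =
            (\<lambda>h n. y (h \<otimes>\<^bsub>G\<^esub> \<pi> n)) ` (\<lambda>h. inv\<^bsub>G\<^esub> g \<otimes>\<^bsub>G\<^esub> h) ` carrier G"
          unfolding W_def image_image by (rule image_cong[OF refl])
        moreover have "(\<lambda>h. inv\<^bsub>G\<^esub> g \<otimes>\<^bsub>G\<^esub> h) ` carrier G = carrier G"
          using g by (intro surj_const_mult) simp
        ultimately show ?thesis by (simp add: W_def)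
      qed
      ultimately show ?thesis using y by (simp add: B_def)
    qed
    then show ?thesis by (auto simp: invariant_under_def orbit_equivalence_def)
  qed

  \<comment> \<open>Definability of the payoff\<close>
  have "B' \<in> \<Gamma> ?Z"
  proof -
    define K where "K a h = {x \<in> topspace ?Z. obeys c a (x \<circ> \<tau> h)}" for a h
    have K: "closedin ?Z (K a h)" for a h
      unfolding K_def by (rule closedin_obeys_reindex)
    have N: "fsigma_in ?Z (\<Union>h\<in>carrier G. K a h)" for a
      by (rule fsigma_in_Union) (use assms(2) K closed_imp_fsigma_in in auto)
    \<comment> \<open>This is the second way for I to win: some translate obeys for I and none obeys
      for II.\<close>
    define D where "D = (\<Union>h\<in>carrier G. K 2 h) \<inter> (topspace ?Z - (\<Union>h\<in>carrier G. K 3 h))"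
    have "D \<in> Delta0 ?Z 3"
      unfolding D_def using N by (intro fsigma_Int_gdelta_in_Delta0 mZ) (auto simp: fsigma_in_gdelta_in)
    then have D: "D \<in> Delta0 ?Z 6"
      by (rule Delta0_mono[OF mZ, rotated 2]) auto
    have "{x \<in> topspace ?Z. \<exists>h\<in>carrier G. x \<in> K 2 h \<inter> K 3 h \<and> x \<circ> (\<tau> h \<circ> free_time) \<in> A} \<union> D \<in> \<Gamma> ?Z"
    \<comment> \<open>The pieces are indexed by the origin \<open>h\<close> of an obedient play; on
      each piece the free part is a continuous reindexing of \<open>x\<close>.\<close>
    proof (rule reasonable_pointclass_piecewise[OF assms(5) Z A _ assms(2) _ _ _ D])
      show "(\<lambda>_. 0) \<in> topspace ?Z" using S by (simp add: topspace_power_space_UNIV)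
      show "closedin ?Z (K 2 h \<inter> K 3 h)" for h using K by (intro closedin_Int)
      show "continuous_map ?Z ?Z (\<lambda>x. x \<circ> (\<tau> h \<circ> free_time))" for h
        by (rule continuous_map_reindex)
    next
      fix g h x assume gh: "g \<in> carrier G" "h \<in> carrier G" "x \<in> K 2 g \<inter> K 3 g" "x \<in> K 2 h \<inter> K 3 h"
      \<comment> \<open>Two origins \<open>g\<close> and \<open>h\<close> differ by translation by
        \<open>inv g\<close> times \<open>h\<close>. Both translates obey, so this element is the
        identity and the pieces are disjoint.\<close>
      have "\<tau> g \<circ> \<tau> (inv\<^bsub>G\<^esub> g \<otimes>\<^bsub>G\<^esub> h) = \<tau> h"
        using gh by (simp add: \<tau>_mult m_assoc[symmetric])
      then have "obeys c 2 ((x \<circ> \<tau> g) \<circ> \<tau> (inv\<^bsub>G\<^esub> g \<otimes>\<^bsub>G\<^esub> h))"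
        using gh by (simp add: K_def comp_assoc)
      then have "inv\<^bsub>G\<^esub> g \<otimes>\<^bsub>G\<^esub> h = \<one>\<^bsub>G\<^esub>"
        using only_origin[of "inv\<^bsub>G\<^esub> g \<otimes>\<^bsub>G\<^esub> h" 2 2 "x \<circ> \<tau> g"] gh by (auto simp: K_def)
      then show "g = h" using gh by (metis inv_closed inv_equality inv_inv)
    qed
    moreover have "{x \<in> topspace ?Z. \<exists>h\<in>carrier G. x \<in> K 2 h \<inter> K 3 h \<and> x \<circ> (\<tau> h \<circ> free_time) \<in> A} \<union> D = B'"
      by (rule Set.set_eqI) (auto simp: B' win_def D_def K_def comp_assoc)
    ultimately show ?thesis by simp
  qed
  \<comment> \<open>\<open>B'\<close> is the homeomorphic copy of \<open>B\<close> in the sequence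
    space and witnesses that \<open>B\<close> belongs to the pointclass.\<close>
  moreover have "(\<lambda>y n. y (\<pi> n)) ` B = B'"
  proof (intro subset_antisym subsetI)
    fix x assume "x \<in> (\<lambda>y n. y (\<pi> n)) ` B"
    then obtain y where y: "y \<in> B" "x = (\<lambda>n. y (\<pi> n))" by auto
    then have yX: "y \<in> topspace ?X" by (simp add: B_def)
    then have "induced_map G \<pi> x = y" "x \<in> topspace ?Z"
      using hom y by (auto simp: homeomorphic_maps_def continuous_map_def)
    then show "x \<in> B'" using y by (simp add: B'_def)
  next
    fix x assume x: "x \<in> B'"
    then have "x = (\<lambda>n. induced_map G \<pi> x (\<pi> n))"
      using hom by (simp add: B'_def homeomorphic_maps_def)
    then show "x \<in> (\<lambda>y n. y (\<pi> n)) ` B" using x unfolding B'_def by blast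
  qed
  ultimately have "in_pointclass \<Gamma> ?X B"
    using hom unfolding in_pointclass_def homeomorphic_map_maps
    by (intro conjI exI[of _ ?Z] exI[of _ "\<lambda>y n. y (\<pi> n)"]) (auto simp: B_def)
  with inv \<pi> assms(6) have "determined S B'"
    unfolding orbit_determinacy_def B'_def by blast

  \<comment> \<open>Return to the original game\<close>
  then show "determined S A"
  proof (rule determined_without_forced_moves[where c = c, OF _ S(1) cS])
    have self: "x \<in> (\<lambda>h. x \<circ> \<tau> h) ` carrier G" for x
      by (rule image_eqI[of _ _ "\<one>\<^bsub>G\<^esub>"]) auto
    {
      fix x assume x: "obeys c 3 x" "x \<in> B'"
      \<comment> \<open>Since \<open>x\<close> itself obeys for II, the second way of winning is
        excluded, so some translate wins in the first way; by \<open>only_origin\<close> it is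
        \<open>x\<close>.\<close>
      then have "\<exists>w\<in>(\<lambda>h. x \<circ> \<tau> h) ` carrier G. obeys c 2 w \<and> w \<circ> free_time \<in> A"
        using self[of x] by (auto simp: B' win_def)
      then obtain h where h: "h \<in> carrier G" "obeys c 2 (x \<circ> \<tau> h)" "x \<circ> \<tau> h \<circ> free_time \<in> A" by auto
      then have "h = \<one>\<^bsub>G\<^esub>" using only_origin[of h 3 2 x] x by auto
      with h show "x \<circ> free_time \<in> A" by simp
    next
      fix x assume x: "range x \<subseteq> S" "obeys c 2 x" "x \<notin> B'"
      then have lose: "\<not> win ((\<lambda>h. x \<circ> \<tau> h) ` carrier G)" by (simp add: B' topspace_power_space_UNIV)
      \<comment> \<open>Since \<open>x\<close> obeys for I and still loses, some translate must obey
        for II. It is \<open>x\<close> itself, so only a free part outside \<open>A\<close> can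
        explain the loss.\<close>
      then obtain h where h: "h \<in> carrier G" "obeys c 3 (x \<circ> \<tau> h)"
        using self[of x] x unfolding win_def by blast
      then have "h = \<one>\<^bsub>G\<^esub>" using only_origin[of h 2 3 x] x by auto
      then have "obeys c 3 x" using h by simp
      then show "x \<circ> free_time \<notin> A" using lose self[of x] x unfolding win_def by blast
    }
  qed
qed

end
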